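(* Let $\mathcal{L}$ be a finite lattice, let $x_0\in\mathcal{L}$, and let $B\subseteq\mathcal{L}$ be a border for $x_0$. For all $x_1\in\mathcal{L}$ with $x_0<x_1$, the following are equivalent: (1) $x_1\in\mathrm{uc}(x_0)$, that is, $x_0\prec x_1$; (2) there is $y\in B$ such that $x_1=x_0\lor y$ and, for all $z\in B$, if $(x_0\lor z)\leq(x_0\lor y)$ then $(x_0\lor z)=(x_0\lor y)$.
   Context: $x\prec y$ means that $x$ is an immediate predecessor of $y$: $x<y$ and there is no $w$ with $x<w<y$. The upper cover of $x$ is $\mathrm{uc}(x)=\{y : x\prec y\}$. Given $x\in\mathcal{L}$ and $B\subseteq\mathcal{L}$, $B$ is a border for $x$ if: (i) for all $y\in B$, $y\not\leq x$; and (ii) for every $z\in\mathcal{L}$ with $x\prec z$ there is $y\in B$ with $y\leq z$. *)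

theory Defs
  imports Main
begin

definition covered_by :: "'a::order \<Rightarrow> 'a \<Rightarrow> bool" (infix "\<prec>" 50)
  where "x \<prec> y \<longleftrightarrow> x < y \<and> \<not> (\<exists>w. x < w \<and> w < y)"

definition uc :: "'a::order \<Rightarrow> 'a set"
  where "uc x = {y. x \<prec> y}"

definition border :: "'a::order \<Rightarrow> 'a set \<Rightarrow> bool"
  where "border x B \<longleftrightarrow> (\<forall>y\<in>B. \<not> y \<le> x) \<and> (\<forall>z. x \<prec> z \<longrightarrow> (\<exists>y\<in>B. y \<le> z))"

end

theory Submission
  imports Defs
begin

text \<open>The covers of \<open>x\<^sub>0\<close> are the minimal elements among the joins of
  \<open>x\<^sub>0\<close> with members of \<open>B\<close>. Every cover is such a join, since a
  border element below it cannot lie below \<open>x\<^sub>0\<close> (\<open>sup_eq_cover\<close>).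
  Conversely, by finiteness a minimal join has a cover below it (\<open>exists_cover_le\<close>);
  that cover is itself a join, so minimality makes the two equal.\<close>

lemma exists_cover_le:
  fixes x y :: "'a::{finite, order}"
  assumes "x < y"
  obtains c where "x \<prec> c" "c \<le> y"
proof -
  have "finite {w. x < w}" "y \<in> {w. x < w}"
    using assms by simp_all
  \<comment> \<open>A minimal element above \<open>x\<close>, chosen below \<open>y\<close>, leaves
    no room for an element between it and \<open>x\<close>.\<close>
  then obtain c where c: "x < c" "c \<le> y" and min: "\<And>w. x < w \<Longrightarrow> w \<le> c \<Longrightarrow> c = w"
    using finite_has_minimal2[of "{w. x < w}" y] by auto
  have "x \<prec> c"
    unfolding covered_by_def using c(1) min less_imp_le by blast
  with c(2) that show thesis by blast
qed

text \<open>The join is squeezed: it exceeds \<open>x\<close> strictly because \<open>y\<close> is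
  not below \<open>x\<close>, and it stays below the cover \<open>c\<close>.\<close>

lemma sup_eq_cover:
  fixes x c y :: "'a::lattice"
  assumes "x \<prec> c" "y \<le> c" "\<not> y \<le> x"
  shows "sup x y = c"
proof -
  have "x < sup x y"
    using assms(3) by (metis less_le sup.cobounded1 sup.cobounded2)
  moreover have "sup x y \<le> c"
    using assms(1,2) by (simp add: covered_by_def less_imp_le)
  ultimately show ?thesis
    using assms(1) by (auto simp: covered_by_def le_less)
qed

theorem theorem1:
  fixes x\<^sub>0 x\<^sub>1 :: "'a::{finite, lattice}" and B :: "'a set"
  assumes "border x\<^sub>0 B" and "x\<^sub>0 < x\<^sub>1"
  shows "x\<^sub>1 \<in> uc x\<^sub>0 \<longleftrightarrow>
    (\<exists>y\<in>B. x\<^sub>1 = sup x\<^sub>0 y \<and> (\<forall>z\<in>B. sup x\<^sub>0 z \<le> sup x\<^sub>0 y \<longrightarrow> sup x\<^sub>0 z = sup x\<^sub>0 y))"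
    (is "_ \<longleftrightarrow> ?R")
proof
  have not_le: "\<not> z \<le> x\<^sub>0" if "z \<in> B" for z
    using assms(1) that by (simp add: border_def)
  have below: "\<exists>z\<in>B. sup x\<^sub>0 z = c" if "x\<^sub>0 \<prec> c" for c
    using assms(1) that sup_eq_cover[OF that] unfolding border_def by blast
  show ?R if "x\<^sub>1 \<in> uc x\<^sub>0"
  proof -
    have cov: "x\<^sub>0 \<prec> x\<^sub>1"
      using that by (simp add: uc_def)
    then obtain y where "y \<in> B" "sup x\<^sub>0 y = x\<^sub>1"
      using below by blast
    \<comment> \<open>A competing \<open>z\<close> lies below \<open>x\<^sub>1\<close> too, so the
      same squeeze applies to it.\<close>
    moreover have "sup x\<^sub>0 z = x\<^sub>1" if "z \<in> B" "sup x\<^sub>0 z \<le> x\<^sub>1" for z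
      using sup_eq_cover[OF cov _ not_le] that by simp
    ultimately show ?thesis by blast
  qed
  show "x\<^sub>1 \<in> uc x\<^sub>0" if ?R
  proof -
    obtain c where c: "x\<^sub>0 \<prec> c" "c \<le> x\<^sub>1"
      using exists_cover_le assms(2) by blast
    \<comment> \<open>Since \<open>c\<close> is the join of \<open>x\<^sub>0\<close> with some
      border element and \<open>c \<le> x\<^sub>1\<close>, the minimality in \<open>?R\<close>
      forces equality.\<close>
    then have "c = x\<^sub>1"
      using below[OF c(1)] \<open>?R\<close> by blast
    with c(1) show ?thesis by (simp add: uc_def)
  qed
qed

end
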